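(* Let $\mathcal L$ be a join-semilattice with greatest element $1$, equipped with a binary operation $\mathbin{\hat{\ }}$ (caret) satisfying the following axioms for all $x,y,z\in\mathcal L$, where $x\rightarrow y$ denotes $y\vee\bigl(1\mathbin{\hat{\ }}(x\mathbin{\hat{\ }}y)\bigr)$: (a) $x\vee(y\mathbin{\hat{\ }}x)=x\vee y$; (b) $(1\mathbin{\hat{\ }}x)\mathbin{\hat{\ }}(1\mathbin{\hat{\ }}y)=1\mathbin{\hat{\ }}(x\mathbin{\hat{\ }}y)$; (c) $1\mathbin{\hat{\ }}(1\mathbin{\hat{\ }}x)=x$; (d) if $x\le y$ then $1\mathbin{\hat{\ }}x\le 1\mathbin{\hat{\ }}y$; (e) (i) $(x\rightarrow y)\rightarrow y=x\vee y$, and (ii) $x\rightarrow(y\rightarrow z)=y\rightarrow(x\rightarrow z)$; (f) $(x\vee y)\rightarrow\bigl((x\vee y)\mathbin{\hat{\ }}y\bigr)=1\mathbin{\hat{\ }}(x\rightarrow y)$; (g) $x\mathbin{\hat{\ }}y\le(x\vee y)\mathbin{\hat{\ }}y$; (h) $x\mathbin{\hat{\ }}y\le x$. Then $\mathcal L$, with $\Delta(a,b)=a\mathbin{\hat{\ }}b$ for $b\le a$, is an MR-algebra.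
   Context: A cubic algebra is a join-semilattice with greatest element $1$ and an operation $\Delta$ (only the values $\Delta(y,x)$ with $x\le y$ matter) such that: (1) $x\le y$ implies $\Delta(y,x)\vee x=y$; (2) $x\le y\le z$ implies $\Delta(z,\Delta(y,x))=\Delta(\Delta(z,y),\Delta(z,x))$; (3) $x\le y$ implies $\Delta(y,\Delta(y,x))=x$; (4) $x\le y\le z$ implies $\Delta(z,x)\le\Delta(z,y)$; and, writing $xy=\Delta(1,\Delta(x\vee y,y))\vee y$, (5) $(xy)y=x\vee y$; (6) $x(yz)=y(xz)$. An MR-algebra is a cubic algebra satisfying the MR-axiom: for all $a,b<x$, $\Delta(x,a)\vee b<x$ if and only if the meet (greatest lower bound) $a\wedge b$ does not exist. *)

theory Defs
  imports Main "HOL-Library.Lub_Glb"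
begin

unbundle lattice_syntax

text \<open>
  The type class constraint \<open>{semilattice_sup, order_top}\<close> is exactly a join-semilattice with
  greatest element. \<open>\<Delta>\<close> is a total function here, but every axiom below applies it only to
  arguments \<open>\<Delta> y x\<close> with \<open>x \<le> y\<close>, so its values elsewhere play no role (in \<open>Delta_Delta\<close> the
  inner applications are again of this kind, by \<open>Delta_sup\<close> and \<open>Delta_mono\<close>).
\<close>

definition cubic_imp :: "('a::{semilattice_sup, order_top} \<Rightarrow> 'a \<Rightarrow> 'a) \<Rightarrow> 'a \<Rightarrow> 'a \<Rightarrow> 'a" where
  "cubic_imp \<Delta> x y = \<Delta> \<top> (\<Delta> (x \<squnion> y) y) \<squnion> y"

locale cubic_algebra =
  fixes \<Delta> :: "'a::{semilattice_sup, order_top} \<Rightarrow> 'a \<Rightarrow> 'a"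
  assumes Delta_sup: "x \<le> y \<Longrightarrow> \<Delta> y x \<squnion> x = y"
    and Delta_Delta: "x \<le> y \<Longrightarrow> y \<le> z \<Longrightarrow> \<Delta> z (\<Delta> y x) = \<Delta> (\<Delta> z y) (\<Delta> z x)"
    and Delta_invol: "x \<le> y \<Longrightarrow> \<Delta> y (\<Delta> y x) = x"
    and Delta_mono: "x \<le> y \<Longrightarrow> y \<le> z \<Longrightarrow> \<Delta> z x \<le> \<Delta> z y"
    and imp_imp: "cubic_imp \<Delta> (cubic_imp \<Delta> x y) y = x \<squnion> y"
    and imp_exchange: "cubic_imp \<Delta> x (cubic_imp \<Delta> y z) = cubic_imp \<Delta> y (cubic_imp \<Delta> x z)"

locale MR_algebra = cubic_algebra +
  assumes MR: "a < x \<Longrightarrow> b < x \<Longrightarrow> \<Delta> x a \<squnion> b < x \<longleftrightarrow> \<not> (\<exists>m. isGlb UNIV {a, b} m)"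

end

theory Submission
  imports Defs
begin

text \<open>
  The arrow makes \<open>\<L>\<close> an implication algebra (every interval \<open>[y, \<top>]\<close> is Boolean, with
  \<open>x \<rightarrow> y\<close> the complement of \<open>x\<close>), so for \<open>y \<le> x\<close> the element \<open>y\<close> is the meet of \<open>x\<close> and
  \<open>x \<rightarrow> y\<close> and is determined by \<open>x\<close> and \<open>x \<rightarrow> y\<close>. The map \<open>x \<mapsto> \<top> \<^bold>^ x\<close>, written \<open>x\<acute>\<close>, is an
  involutive automorphism of it. Axiom (f) says that \<open>x \<^bold>^ y\<close> is the element below \<open>x\<close> with
  \<open>x \<rightarrow> (x \<^bold>^ y) = (x \<rightarrow> y)\<acute>\<close>, and the cubic axioms become computations with meets. For the
  MR-axiom, (g) and (h) make \<open>b \<^bold>^ u\<close> a common lower bound of \<open>b\<close> and \<open>(b \<squnion> u) \<^bold>^ u\<close>; if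
  \<open>u = x \<^bold>^ a\<close> and \<open>u \<squnion> b = x\<close>, the latter is \<open>x \<^bold>^ (x \<^bold>^ a) = a\<close>.
\<close>

section \<open>Implication algebras: order and laws of the arrow\<close>

locale implication_semilattice =
  fixes imp :: "'a::{semilattice_sup, order_top} \<Rightarrow> 'a \<Rightarrow> 'a"  (infixr "\<rightarrow>" 70)
  assumes imp_imp: "(x \<rightarrow> y) \<rightarrow> y = x \<squnion> y"
    and exchange: "x \<rightarrow> (y \<rightarrow> z) = y \<rightarrow> (x \<rightarrow> z)"
    and top_imp: "\<top> \<rightarrow> x = x"
    and sup_imp: "x \<squnion> (x \<rightarrow> y) = \<top>"
begin

lemma imp_self: "x \<rightarrow> x = \<top>"
  using imp_imp[of \<top> x] by (simp add: top_imp sup.absorb1)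

lemma imp_top: "x \<rightarrow> \<top> = \<top>"
proof -
  have "(x \<rightarrow> \<top>) \<rightarrow> (x \<rightarrow> \<top>) = x \<rightarrow> ((x \<rightarrow> \<top>) \<rightarrow> \<top>)"
    by (rule exchange)
  then show ?thesis
    by (simp add: imp_self imp_imp sup.absorb2)
qed

lemma le_imp: "y \<le> x \<rightarrow> y"
proof -
  have "y \<rightarrow> (x \<rightarrow> y) = \<top>"
    by (simp add: exchange[of y] imp_self imp_top)
  then have "y \<squnion> (x \<rightarrow> y) = x \<rightarrow> y"
    using imp_imp[of y "x \<rightarrow> y"] by (simp add: top_imp)
  then show ?thesis
    by (simp add: le_iff_sup)
qed

lemma sup_imp_right: "(x \<squnion> y) \<rightarrow> y = x \<rightarrow> y"
proof -
  have "(x \<squnion> y) \<rightarrow> y = (x \<rightarrow> y) \<squnion> y"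
    by (simp flip: imp_imp[of x y]) (rule imp_imp)
  then show ?thesis
    by (simp add: sup.absorb1 le_imp)
qed

lemma imp_eq_top_iff: "x \<rightarrow> y = \<top> \<longleftrightarrow> x \<le> y"
proof
  assume "x \<rightarrow> y = \<top>"
  then show "x \<le> y"
    using imp_imp[of x y] by (simp add: top_imp le_iff_sup)
next
  assume "x \<le> y"
  then show "x \<rightarrow> y = \<top>"
    using sup_imp_right[of x y] by (simp add: sup.absorb2 imp_self)
qed

text \<open>Exchange, with the order read off from arrows equal to \<open>\<top>\<close>. This takes
  the place of residuation where meets may fail to exist.\<close>

lemma le_imp_swap: "x \<le> y \<rightarrow> z \<longleftrightarrow> y \<le> x \<rightarrow> z"
  unfolding imp_eq_top_iff[symmetric] by (simp add: exchange[of x])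

lemma imp_antimono: "x \<le> y \<Longrightarrow> y \<rightarrow> z \<le> x \<rightarrow> z"
  by (subst le_imp_swap) (simp add: imp_imp le_supI1)

text \<open>As \<open>y = (y \<rightarrow> x) \<rightarrow> x\<close>, exchange turns
  \<open>z \<rightarrow> y\<close> into an arrow ending in \<open>z \<rightarrow> x\<close>.\<close>

lemma imp_mono: "x \<le> y \<Longrightarrow> z \<rightarrow> x \<le> z \<rightarrow> y"
proof -
  assume "x \<le> y"
  then have "(y \<rightarrow> x) \<rightarrow> x = y"
    by (simp add: imp_imp sup.absorb1)
  then have "z \<rightarrow> y = (y \<rightarrow> x) \<rightarrow> (z \<rightarrow> x)"
    using exchange[of z "y \<rightarrow> x" x] by simp
  then show ?thesis
    by (simp add: le_imp)
qed

text \<open>Peirce's law: \<open>imp_imp\<close> turns it into \<open>sup_imp\<close>.\<close>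

lemma imp_imp_left: "(x \<rightarrow> y) \<rightarrow> x = x"
proof (rule antisym)
  have "((x \<rightarrow> y) \<rightarrow> x) \<rightarrow> x = \<top>"
    using imp_imp[of "x \<rightarrow> y" x] sup_imp[of x y] by (simp add: sup_commute)
  then show "(x \<rightarrow> y) \<rightarrow> x \<le> x"
    by (simp add: imp_eq_top_iff)
qed (rule le_imp)

lemma imp_contract: "x \<rightarrow> (x \<rightarrow> y) = x \<rightarrow> y"
  using imp_imp_left[of "x \<rightarrow> y" x] by (simp add: imp_imp_left)

text \<open>For one direction, \<open>x \<rightarrow>\<close> is applied to modus ponens
  \<open>y \<le> ?t \<rightarrow> (x \<rightarrow> z)\<close> and the repeated \<open>x\<close> is
  contracted.\<close>

lemma imp_distrib: "x \<rightarrow> (y \<rightarrow> z) = (x \<rightarrow> y) \<rightarrow> (x \<rightarrow> z)"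
proof (rule antisym)
  let ?t = "x \<rightarrow> (y \<rightarrow> z)"
  have "y \<le> ?t \<rightarrow> (x \<rightarrow> z)"
    by (subst le_imp_swap) (simp add: exchange[of y])
  then have "x \<rightarrow> y \<le> x \<rightarrow> (?t \<rightarrow> (x \<rightarrow> z))"
    by (rule imp_mono)
  also have "\<dots> = ?t \<rightarrow> (x \<rightarrow> z)"
    by (simp add: exchange[of x ?t] imp_contract)
  finally show "?t \<le> (x \<rightarrow> y) \<rightarrow> (x \<rightarrow> z)"
    by (subst le_imp_swap)
next
  show "(x \<rightarrow> y) \<rightarrow> (x \<rightarrow> z) \<le> x \<rightarrow> (y \<rightarrow> z)"
    by (subst exchange[of x y]) (rule imp_antimono, rule le_imp)
qed

lemma imp_absorb: "x \<squnion> y = \<top> \<Longrightarrow> x \<rightarrow> y = y"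
  using sup_imp_right[of x y] by (simp add: top_imp)

text \<open>The last conjunct is a residuated form of being the greatest lower bound. Built from
  order and arrow alone, the notion is preserved by \<open>z \<rightarrow>\<close> and by the
  reflection.\<close>

definition is_meet :: "'a \<Rightarrow> 'a \<Rightarrow> 'a \<Rightarrow> bool" where
  "is_meet x y m \<longleftrightarrow> m \<le> x \<and> m \<le> y \<and> x \<le> y \<rightarrow> m"

lemma is_meet_greatest:
  assumes m: "is_meet x y m" and "u \<le> x" "u \<le> y"
  shows "u \<le> m"
proof -
  have "u \<le> y \<rightarrow> m"
    using m \<open>u \<le> x\<close> by (auto simp: is_meet_def)
  also have "\<dots> \<le> u \<rightarrow> m"
    using \<open>u \<le> y\<close> by (rule imp_antimono)
  finally have "u \<rightarrow> (u \<rightarrow> m) = \<top>"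
    by (simp add: imp_eq_top_iff)
  then show ?thesis
    by (simp add: imp_contract imp_eq_top_iff)
qed

lemma is_meet_unique: "is_meet x y m \<Longrightarrow> is_meet x y n \<Longrightarrow> m = n"
  by (meson antisym is_meet_def is_meet_greatest)

lemma is_meet_isGlb: "is_meet x y m \<Longrightarrow> isGlb UNIV {x, y} m"
  unfolding isGlb_def greatestP_def isLb_def
  by (auto simp: setge_def setle_def is_meet_def intro: is_meet_greatest)

text \<open>In the Boolean interval above \<open>u\<close>, \<open>?k\<close> is the complement of
  the desired meet and \<open>?m\<close> the complement of \<open>?k\<close>.\<close>

lemma ex_is_meet:
  assumes "u \<le> x" "u \<le> y"
  shows "\<exists>m. is_meet x y m"
proof -
  let ?k = "x \<rightarrow> (y \<rightarrow> u)"
  let ?m = "?k \<rightarrow> u"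
  have "?m \<le> (x \<rightarrow> u) \<rightarrow> u"
    by (intro imp_antimono imp_mono le_imp)
  then have "?m \<le> x"
    using \<open>u \<le> x\<close> by (simp add: imp_imp sup.absorb1)
  have "?m \<le> (y \<rightarrow> u) \<rightarrow> u"
    by (intro imp_antimono le_imp)
  then have "?m \<le> y"
    using \<open>u \<le> y\<close> by (simp add: imp_imp sup.absorb1)
  have "x \<rightarrow> (y \<rightarrow> ?m) = ?k \<rightarrow> ?k"
    by (simp only: exchange[of y ?k] exchange[of x ?k])
  then have "x \<le> y \<rightarrow> ?m"
    by (simp add: imp_self flip: imp_eq_top_iff)
  with \<open>?m \<le> x\<close> \<open>?m \<le> y\<close> show ?thesis
    by (auto simp: is_meet_def)
qed

lemma is_meet_imp: "y \<le> x \<Longrightarrow> is_meet x (x \<rightarrow> y) y"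
  by (simp add: is_meet_def le_imp imp_imp)

lemma imp_inject: "y \<le> x \<Longrightarrow> z \<le> x \<Longrightarrow> x \<rightarrow> y = x \<rightarrow> z \<Longrightarrow> y = z"
  by (metis is_meet_imp is_meet_unique)

lemma imp_is_meet: "is_meet x y m \<Longrightarrow> is_meet (z \<rightarrow> x) (z \<rightarrow> y) (z \<rightarrow> m)"
  unfolding is_meet_def by (auto simp: imp_mono simp flip: imp_distrib)

text \<open>Under \<open>z \<rightarrow>\<close> the factor \<open>x\<close> becomes
  \<open>\<top>\<close> and drops out of the meet.\<close>

lemma imp_is_meet_le:
  assumes "is_meet x y m" "z \<le> x"
  shows "z \<rightarrow> m = z \<rightarrow> y"
proof -
  have "is_meet \<top> (z \<rightarrow> y) (z \<rightarrow> m)"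
    using imp_is_meet[OF assms(1), of z] imp_eq_top_iff[of z x] assms(2) by simp
  then show ?thesis
    by (metis antisym is_meet_def is_meet_greatest order_refl top_greatest)
qed

text \<open>Currying for a meet in the antecedent.\<close>

lemma is_meet_imp_left:
  assumes m: "is_meet x y m"
  shows "m \<rightarrow> z = x \<rightarrow> (y \<rightarrow> z)"
proof (rule antisym)
  have "m \<rightarrow> z \<le> y \<rightarrow> (m \<rightarrow> z)"
    by (rule le_imp)
  also have "\<dots> = (y \<rightarrow> m) \<rightarrow> (y \<rightarrow> z)"
    by (rule imp_distrib)
  also have "\<dots> \<le> x \<rightarrow> (y \<rightarrow> z)"
    using m by (intro imp_antimono) (simp add: is_meet_def)
  finally show "m \<rightarrow> z \<le> x \<rightarrow> (y \<rightarrow> z)" .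
next
  have "x \<rightarrow> (y \<rightarrow> z) \<le> m \<rightarrow> (m \<rightarrow> z)"
    using m by (meson imp_antimono imp_mono is_meet_def order_trans)
  then show "x \<rightarrow> (y \<rightarrow> z) \<le> m \<rightarrow> z"
    by (simp add: imp_contract)
qed

end

section \<open>The caret: reflection, cubic axioms and the MR-axiom\<close>

locale caret_algebra =
  fixes caret :: "'a::{semilattice_sup, order_top} \<Rightarrow> 'a \<Rightarrow> 'a"  (infixl "\<^bold>^" 75)
    and arrow :: "'a \<Rightarrow> 'a \<Rightarrow> 'a"  (infixr "\<rightarrow>" 70)
  assumes arrow: "x \<rightarrow> y = y \<squnion> (\<top> \<^bold>^ (x \<^bold>^ y))"
    and sup_caret: "x \<squnion> (y \<^bold>^ x) = x \<squnion> y"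
    and caret_top_caret: "(\<top> \<^bold>^ x) \<^bold>^ (\<top> \<^bold>^ y) = \<top> \<^bold>^ (x \<^bold>^ y)"
    and top_caret_invol: "\<top> \<^bold>^ (\<top> \<^bold>^ x) = x"
    and top_caret_mono: "x \<le> y \<Longrightarrow> \<top> \<^bold>^ x \<le> \<top> \<^bold>^ y"
    and arrow_arrow: "(x \<rightarrow> y) \<rightarrow> y = x \<squnion> y"
    and arrow_exchange: "x \<rightarrow> (y \<rightarrow> z) = y \<rightarrow> (x \<rightarrow> z)"
    and arrow_caret_sup: "(x \<squnion> y) \<rightarrow> ((x \<squnion> y) \<^bold>^ y) = \<top> \<^bold>^ (x \<rightarrow> y)"
    and caret_le_sup_caret: "x \<^bold>^ y \<le> (x \<squnion> y) \<^bold>^ y"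
    and caret_le: "x \<^bold>^ y \<le> x"
begin

sublocale implication_semilattice arrow
proof
  fix x y z
  show "\<top> \<rightarrow> x = x"
    by (simp add: arrow top_caret_invol)
  \<comment> \<open>The left side is an element joined with its reflection, which is
    \<open>\<top>\<close> by \<open>sup_caret\<close>.\<close>
  have "x \<^bold>^ y \<squnion> \<top> \<^bold>^ (x \<^bold>^ y) \<le> x \<squnion> (x \<rightarrow> y)"
    unfolding arrow by (meson caret_le order_refl sup.mono sup_ge2)
  then show "x \<squnion> (x \<rightarrow> y) = \<top>"
    using sup_caret[of "x \<^bold>^ y" \<top>] by (simp add: top_unique)
qed (rule arrow_arrow arrow_exchange)+

abbreviation refl :: "'a \<Rightarrow> 'a"  ("_\<acute>" [1000] 1000) where
  "x\<acute> \<equiv> \<top> \<^bold>^ x"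

lemma refl_le_refl_iff: "x\<acute> \<le> y\<acute> \<longleftrightarrow> x \<le> y"
  by (metis top_caret_invol top_caret_mono)

lemma refl_sup: "(x \<squnion> y)\<acute> = x\<acute> \<squnion> y\<acute>"
proof (rule antisym)
  have "x \<le> (x\<acute> \<squnion> y\<acute>)\<acute>" "y \<le> (x\<acute> \<squnion> y\<acute>)\<acute>"
    by (metis refl_le_refl_iff top_caret_invol sup_ge1 sup_ge2)+
  then show "(x \<squnion> y)\<acute> \<le> x\<acute> \<squnion> y\<acute>"
    by (metis le_sup_iff refl_le_refl_iff top_caret_invol)
qed (simp add: refl_le_refl_iff)

lemma refl_imp: "(x \<rightarrow> y)\<acute> = x\<acute> \<rightarrow> y\<acute>"
  by (simp add: arrow refl_sup caret_top_caret)

lemma refl_is_meet: "is_meet x y m \<Longrightarrow> is_meet x\<acute> y\<acute> m\<acute>"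
  by (simp add: is_meet_def refl_le_refl_iff flip: refl_imp)

lemma imp_caret: "y \<le> x \<Longrightarrow> x \<rightarrow> (x \<^bold>^ y) = (x \<rightarrow> y)\<acute>"
  using arrow_caret_sup[of x y] by (simp add: sup.absorb1)

lemma caret_invol: "y \<le> x \<Longrightarrow> x \<^bold>^ (x \<^bold>^ y) = y"
  by (rule imp_inject[of _ x]) (simp_all add: caret_le imp_caret top_caret_invol)

lemma is_meet_caret: "y \<le> x \<Longrightarrow> is_meet x (x \<rightarrow> y)\<acute> (x \<^bold>^ y)"
  by (metis caret_le imp_caret is_meet_imp)

lemma caret_mono:
  assumes "x \<le> y" "y \<le> z"
  shows "z \<^bold>^ x \<le> z \<^bold>^ y"
proof (rule is_meet_greatest[OF is_meet_caret[OF \<open>y \<le> z\<close>] caret_le])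
  have "z \<^bold>^ x \<le> (z \<rightarrow> x)\<acute>"
    using is_meet_caret[of x z] assms by (auto simp: is_meet_def)
  also have "\<dots> \<le> (z \<rightarrow> y)\<acute>"
    using \<open>x \<le> y\<close> by (intro top_caret_mono imp_mono)
  finally show "z \<^bold>^ x \<le> (z \<rightarrow> y)\<acute>" .
qed

text \<open>Both sides lie below \<open>z\<close>, so it suffices to compare their images under
  \<open>z \<rightarrow>\<close>. Each image is the meet of \<open>Y\<acute>\<close> and
  \<open>z\<acute> \<rightarrow> C\<close>.\<close>

lemma caret_caret:
  assumes "x \<le> y" "y \<le> z"
  shows "z \<^bold>^ (y \<^bold>^ x) = (z \<^bold>^ y) \<^bold>^ (z \<^bold>^ x)"
proof -
  define Y C w v p R where "Y = z \<rightarrow> y" and "C = y \<rightarrow> x"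
    and "w = z \<^bold>^ y" and "v = z \<^bold>^ x" and "p = y \<^bold>^ x" and "R = w \<^bold>^ v"
  have "x \<le> z" "p \<le> y" "p \<le> z" "w \<le> z" "R \<le> w" "R \<le> z" "v \<le> w"
    using assms caret_le[of y x] caret_le[of z y] caret_le[of w v] caret_mono[of x y z]
    by (auto simp: p_def w_def v_def R_def)
  have imp_w: "z \<rightarrow> w = Y\<acute>" and imp_v: "z \<rightarrow> v = (z \<rightarrow> x)\<acute>"
    and imp_p: "y \<rightarrow> p = C\<acute>" and imp_R: "w \<rightarrow> R = (w \<rightarrow> v)\<acute>"
    using assms \<open>x \<le> z\<close> \<open>v \<le> w\<close>
    by (simp_all add: imp_caret w_def v_def p_def R_def Y_def C_def)
  \<comment> \<open>\<open>C\<close> joins with \<open>y\<close> to \<open>\<top>\<close>, hence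
    also with \<open>z\<close> and \<open>Y\<close>, which lie above \<open>y\<close>. Arrows from
    these into \<open>C\<close> therefore collapse to \<open>C\<close>.\<close>
  have "y \<squnion> C \<le> z \<squnion> C" "y \<squnion> C \<le> Y \<squnion> C"
    using \<open>y \<le> z\<close> le_imp[of y z] by (auto simp: Y_def intro: le_supI1)
  then have "z \<squnion> C = \<top>" "Y \<squnion> C = \<top>"
    using sup_imp[of y x] by (simp_all add: C_def top_unique)
  then have zC: "z \<rightarrow> C = C" and YC: "Y\<acute> \<rightarrow> C\<acute> = C\<acute>"
    by (simp_all add: imp_absorb flip: refl_imp)
  have "is_meet Y (z \<rightarrow> C) (z \<rightarrow> x)"
    unfolding Y_def C_def by (intro imp_is_meet is_meet_imp assms)
  then have v: "is_meet Y\<acute> C\<acute> (z \<rightarrow> v)"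
    unfolding zC imp_v by (rule refl_is_meet)
  have w: "is_meet z Y\<acute> w"
    using is_meet_imp[OF \<open>w \<le> z\<close>] by (simp add: imp_w)
  \<comment> \<open>Since \<open>w\<close> lies below \<open>z\<close> and \<open>Y\<acute>\<close>,
    these factors of \<open>v\<close> vanish under \<open>w \<rightarrow>\<close>, leaving
    \<open>C\<acute>\<close>. Currying \<open>w\<close> and \<open>YC\<close> then leave only
    \<open>z\<close> in front.\<close>
  have "w \<rightarrow> v = w \<rightarrow> (z \<rightarrow> v)"
    using \<open>v \<le> w\<close> \<open>w \<le> z\<close> by (intro imp_is_meet_le[of z] is_meet_imp) auto
  also have "\<dots> = w \<rightarrow> C\<acute>"
    using v w by (intro imp_is_meet_le) (auto simp: is_meet_def)
  also have "\<dots> = z \<rightarrow> C\<acute>"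
    by (simp add: is_meet_imp_left[OF w] YC)
  finally have "w \<rightarrow> R = z\<acute> \<rightarrow> C"
    by (simp add: imp_R refl_imp top_caret_invol)
  then have "z \<rightarrow> (w \<rightarrow> R) = z\<acute> \<rightarrow> C"
    by (simp add: exchange[of z] zC)
  then have R: "is_meet Y\<acute> (z\<acute> \<rightarrow> C) (z \<rightarrow> R)"
    using imp_is_meet[OF is_meet_imp[OF \<open>R \<le> w\<close>], of z] by (simp add: imp_w)
  have "is_meet Y (z \<rightarrow> C\<acute>) (z \<rightarrow> p)"
    using imp_is_meet[OF is_meet_imp[OF \<open>p \<le> y\<close>], of z] by (simp add: imp_p Y_def)
  then have "is_meet Y\<acute> (z\<acute> \<rightarrow> C) (z \<rightarrow> p)\<acute>"
    by (auto dest: refl_is_meet simp: refl_imp top_caret_invol)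
  with R have "z \<rightarrow> (z \<^bold>^ p) = z \<rightarrow> R"
    using \<open>p \<le> z\<close> by (metis imp_caret is_meet_unique)
  then have "z \<^bold>^ p = R"
    using \<open>R \<le> z\<close> by (intro imp_inject[OF caret_le])
  then show ?thesis
    by (simp add: p_def R_def w_def v_def)
qed

lemma caret_sup_eq_iff:
  assumes "a \<le> x" "b \<le> x"
  shows "x \<^bold>^ a \<squnion> b = x \<longleftrightarrow> (\<exists>m. isGlb UNIV {a, b} m)"
proof
  assume sup: "x \<^bold>^ a \<squnion> b = x"
  have "b \<^bold>^ (x \<^bold>^ a) \<le> (b \<squnion> x \<^bold>^ a) \<^bold>^ (x \<^bold>^ a)"
    by (rule caret_le_sup_caret)
  then have "b \<^bold>^ (x \<^bold>^ a) \<le> a"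
    using sup assms by (simp add: sup_commute caret_invol)
  then show "\<exists>m. isGlb UNIV {a, b} m"
    using ex_is_meet caret_le is_meet_isGlb by blast
next
  assume "\<exists>m. isGlb UNIV {a, b} m"
  then obtain m where "m \<le> a" "m \<le> b"
    by (auto simp: isGlb_def greatestP_def isLb_def setge_def)
  then have "m \<le> x"
    using assms by simp
  have "x = m \<squnion> x \<^bold>^ m"
    using sup_caret[of m x] \<open>m \<le> x\<close> by (simp add: sup.absorb2)
  also have "\<dots> \<le> b \<squnion> x \<^bold>^ a"
    using \<open>m \<le> a\<close> \<open>m \<le> b\<close> assms by (intro sup.mono caret_mono)
  finally show "x \<^bold>^ a \<squnion> b = x"
    using assms caret_le by (intro antisym) (auto simp: sup_commute)
qed

lemma MR_algebra:
  assumes Delta: "\<And>x y. y \<le> x \<Longrightarrow> \<Delta> x y = x \<^bold>^ y"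
  shows "MR_algebra \<Delta>"
proof
  \<comment> \<open>Unfolding gives the arrow from \<open>x \<squnion> y\<close> to
    \<open>y\<close>, which \<open>sup_imp_right\<close> reduces to the arrow from
    \<open>x\<close>.\<close>
  have imp: "cubic_imp \<Delta> x y = x \<rightarrow> y" for x y
    using arrow[of "x \<squnion> y" y] by (simp add: cubic_imp_def Delta sup_imp_right sup_commute)
  fix x y z :: 'a
  show "cubic_imp \<Delta> (cubic_imp \<Delta> x y) y = x \<squnion> y"
    by (simp add: imp imp_imp)
  show "cubic_imp \<Delta> x (cubic_imp \<Delta> y z) = cubic_imp \<Delta> y (cubic_imp \<Delta> x z)"
    by (simp add: imp exchange[of x])
next
  fix x y :: 'a
  assume "x \<le> y"
  then show "\<Delta> y x \<squnion> x = y"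
    using sup_caret[of x y] by (simp add: Delta sup_commute sup.absorb2)
  show "\<Delta> y (\<Delta> y x) = x"
    using \<open>x \<le> y\<close> by (simp add: Delta caret_le caret_invol)
next
  fix x y z :: 'a
  assume "x \<le> y" "y \<le> z"
  \<comment> \<open>This bound lets \<open>Delta\<close> rewrite the outer application in
    \<open>\<Delta> z (\<Delta> y x)\<close>.\<close>
  moreover from this have "y \<^bold>^ x \<le> z"
    by (meson caret_le order_trans)
  ultimately show "\<Delta> z (\<Delta> y x) = \<Delta> (\<Delta> z y) (\<Delta> z x)" "\<Delta> z x \<le> \<Delta> z y"
    by (simp_all add: Delta caret_caret caret_mono order_trans[of x y z])
next
  fix a b x :: 'a
  assume "a < x" "b < x"
  then have "\<Delta> x a \<squnion> b \<le> x" "\<Delta> x a = x \<^bold>^ a"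
    by (simp_all add: Delta caret_le less_imp_le)
  then show "\<Delta> x a \<squnion> b < x \<longleftrightarrow> \<not> (\<exists>m. isGlb UNIV {a, b} m)"
    using caret_sup_eq_iff[of a x b] \<open>a < x\<close> \<open>b < x\<close> by (auto simp: less_le)
qed

end

theorem theorem3p1:
  fixes caret :: "'a::{semilattice_sup, order_top} \<Rightarrow> 'a \<Rightarrow> 'a"  (infixl "\<^bold>^" 75)
    and arrow :: "'a \<Rightarrow> 'a \<Rightarrow> 'a"  (infixr "\<rightarrow>" 70)
    and \<Delta> :: "'a \<Rightarrow> 'a \<Rightarrow> 'a"
  assumes arrow: "\<And>x y. x \<rightarrow> y = y \<squnion> (\<top> \<^bold>^ (x \<^bold>^ y))"
    and a: "\<And>x y. x \<squnion> (y \<^bold>^ x) = x \<squnion> y"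
    and b: "\<And>x y. (\<top> \<^bold>^ x) \<^bold>^ (\<top> \<^bold>^ y) = \<top> \<^bold>^ (x \<^bold>^ y)"
    and c: "\<And>x. \<top> \<^bold>^ (\<top> \<^bold>^ x) = x"
    and d: "\<And>x y. x \<le> y \<Longrightarrow> \<top> \<^bold>^ x \<le> \<top> \<^bold>^ y"
    and e1: "\<And>x y. (x \<rightarrow> y) \<rightarrow> y = x \<squnion> y"
    and e2: "\<And>x y z. x \<rightarrow> (y \<rightarrow> z) = y \<rightarrow> (x \<rightarrow> z)"
    and f: "\<And>x y. (x \<squnion> y) \<rightarrow> ((x \<squnion> y) \<^bold>^ y) = \<top> \<^bold>^ (x \<rightarrow> y)"
    and g: "\<And>x y. x \<^bold>^ y \<le> (x \<squnion> y) \<^bold>^ y"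
    and h: "\<And>x y. x \<^bold>^ y \<le> x"
    and Delta: "\<And>x y. y \<le> x \<Longrightarrow> \<Delta> x y = x \<^bold>^ y"
  shows "MR_algebra \<Delta>"
proof -
  interpret caret_algebra caret arrow
    by (unfold_locales; fact)
  show ?thesis
    using Delta by (rule MR_algebra)
qed

end
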